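(* Let $L$ be a first-order language, $\Gamma$ a set of unary $L$-types, $\{M_i:i\in I\}$ a family of $L$-structures each omitting every type in $\Gamma$, and $U$ an ultrafilter on $I$. If $U$ is $\chi$-complete, where $\chi>|\Gamma|$ and $\chi>|p|$ for all $p\in\Gamma$, then $\prod^\Gamma M_i/U=\prod M_i/U$.
   Context: A unary $L$-type is a set of $L$-formulas in one free variable $x$. A choice function on $\Gamma$ is a map $\mathcal{C}$ assigning to each $p\in\Gamma$ a formula $\mathcal{C}(p)\in p$. $\prod^\Gamma M_i$ is the set of $f\in\prod_{i\in I}M_i$ for which there are $X_f\in U$ and a choice function $\mathcal{C}$ with $M_i\models\neg\mathcal{C}(p)(f(i))$ for all $p\in\Gamma$ and $i\in X_f$; $\prod^\Gamma M_i/U=\{[f]_U:f\in\prod^\Gamma M_i\}\subseteq\prod M_i/U$. $U$ is $\chi$-complete if it is closed under intersections of fewer than $\chi$ members. *)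

theory Defs
  imports "HOL-Library.FuncSet"
begin

unbundle cardinal_syntax

section \<open>First-order logic with equality\<close>

text \<open>The symbols of a language are carved out of the ambient symbol types
  \<open>'f\<close> and \<open>'r\<close>, so that a language may have no function or no
  relation symbols at all. Constants are function symbols of arity 0.\<close>

record ('f, 'r) language =
  funs :: "'f set"
  fun_arity :: "'f \<Rightarrow> nat"
  rels :: "'r set"
  rel_arity :: "'r \<Rightarrow> nat"

datatype 'f trm = Var nat | App 'f "'f trm list"

datatype ('f, 'r) form =
    Eq "'f trm" "'f trm"
  | Rel 'r "'f trm list"
  | Neg "('f, 'r) form"
  | Conj "('f, 'r) form" "('f, 'r) form"
  | Disj "('f, 'r) form" "('f, 'r) form"
  | Impl "('f, 'r) form" "('f, 'r) form"
  | Forall nat "('f, 'r) form"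
  | Exists nat "('f, 'r) form"

primrec is_trm :: "('f, 'r) language \<Rightarrow> 'f trm \<Rightarrow> bool" where
  "is_trm L (Var n) \<longleftrightarrow> True"
| "is_trm L (App F ts) \<longleftrightarrow>
     F \<in> funs L \<and> length ts = fun_arity L F \<and> list_all (is_trm L) ts"

primrec is_form :: "('f, 'r) language \<Rightarrow> ('f, 'r) form \<Rightarrow> bool" where
  "is_form L (Eq s t) \<longleftrightarrow> is_trm L s \<and> is_trm L t"
| "is_form L (Rel R ts) \<longleftrightarrow>
     R \<in> rels L \<and> length ts = rel_arity L R \<and> (\<forall>t\<in>set ts. is_trm L t)"
| "is_form L (Neg \<phi>) \<longleftrightarrow> is_form L \<phi>"
| "is_form L (Conj \<phi> \<psi>) \<longleftrightarrow> is_form L \<phi> \<and> is_form L \<psi>"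
| "is_form L (Disj \<phi> \<psi>) \<longleftrightarrow> is_form L \<phi> \<and> is_form L \<psi>"
| "is_form L (Impl \<phi> \<psi>) \<longleftrightarrow> is_form L \<phi> \<and> is_form L \<psi>"
| "is_form L (Forall n \<phi>) \<longleftrightarrow> is_form L \<phi>"
| "is_form L (Exists n \<phi>) \<longleftrightarrow> is_form L \<phi>"

primrec fv_trm :: "'f trm \<Rightarrow> nat set" where
  "fv_trm (Var n) = {n}"
| "fv_trm (App F ts) = \<Union> (set (map fv_trm ts))"

primrec fv :: "('f, 'r) form \<Rightarrow> nat set" where
  "fv (Eq s t) = fv_trm s \<union> fv_trm t"
| "fv (Rel R ts) = (\<Union>t\<in>set ts. fv_trm t)"
| "fv (Neg \<phi>) = fv \<phi>"
| "fv (Conj \<phi> \<psi>) = fv \<phi> \<union> fv \<psi>"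
| "fv (Disj \<phi> \<psi>) = fv \<phi> \<union> fv \<psi>"
| "fv (Impl \<phi> \<psi>) = fv \<phi> \<union> fv \<psi>"
| "fv (Forall n \<phi>) = fv \<phi> - {n}"
| "fv (Exists n \<phi>) = fv \<phi> - {n}"

record ('f, 'r, 'a) struct =
  univ :: "'a set"
  fun_int :: "'f \<Rightarrow> 'a list \<Rightarrow> 'a"
  rel_int :: "'r \<Rightarrow> 'a list \<Rightarrow> bool"

definition is_structure :: "('f, 'r) language \<Rightarrow> ('f, 'r, 'a) struct \<Rightarrow> bool" where
  "is_structure L M \<longleftrightarrow> univ M \<noteq> {} \<and>
     (\<forall>F\<in>funs L. \<forall>as\<in>lists (univ M). length as = fun_arity L F \<longrightarrow> fun_int M F as \<in> univ M)"

primrec trm_val :: "('f, 'r, 'a) struct \<Rightarrow> (nat \<Rightarrow> 'a) \<Rightarrow> 'f trm \<Rightarrow> 'a" where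
  "trm_val M e (Var n) = e n"
| "trm_val M e (App F ts) = fun_int M F (map (trm_val M e) ts)"

primrec sat :: "('f, 'r, 'a) struct \<Rightarrow> ('f, 'r) form \<Rightarrow> (nat \<Rightarrow> 'a) \<Rightarrow> bool" where
  "sat M (Eq s t) e \<longleftrightarrow> trm_val M e s = trm_val M e t"
| "sat M (Rel R ts) e \<longleftrightarrow> rel_int M R (map (trm_val M e) ts)"
| "sat M (Neg \<phi>) e \<longleftrightarrow> \<not> sat M \<phi> e"
| "sat M (Conj \<phi> \<psi>) e \<longleftrightarrow> sat M \<phi> e \<and> sat M \<psi> e"
| "sat M (Disj \<phi> \<psi>) e \<longleftrightarrow> sat M \<phi> e \<or> sat M \<psi> e"
| "sat M (Impl \<phi> \<psi>) e \<longleftrightarrow> (sat M \<phi> e \<longrightarrow> sat M \<psi> e)"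
| "sat M (Forall n \<phi>) e \<longleftrightarrow> (\<forall>a\<in>univ M. sat M \<phi> (e(n := a)))"
| "sat M (Exists n \<phi>) e \<longleftrightarrow> (\<exists>a\<in>univ M. sat M \<phi> (e(n := a)))"

section \<open>Unary types\<close>

text \<open>The variable \<open>x\<close> of unary types is \<open>Var 0\<close>.\<close>

definition unary_type :: "('f, 'r) language \<Rightarrow> ('f, 'r) form set \<Rightarrow> bool" where
  "unary_type L p \<longleftrightarrow> (\<forall>\<phi>\<in>p. is_form L \<phi> \<and> fv \<phi> \<subseteq> {0})"

text \<open>\<open>M \<Turnstile> \<phi>(a)\<close>. Only the value of variable 0 matters when \<open>fv \<phi> \<subseteq> {0}\<close>;
  the constant assignment keeps every value inside the universe.\<close>

definition sat_at :: "('f, 'r, 'a) struct \<Rightarrow> ('f, 'r) form \<Rightarrow> 'a \<Rightarrow> bool" where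
  "sat_at M \<phi> a \<longleftrightarrow> sat M \<phi> (\<lambda>_. a)"

definition realizes :: "('f, 'r, 'a) struct \<Rightarrow> ('f, 'r) form set \<Rightarrow> 'a \<Rightarrow> bool" where
  "realizes M p a \<longleftrightarrow> (\<forall>\<phi>\<in>p. sat_at M \<phi> a)"

definition omits :: "('f, 'r, 'a) struct \<Rightarrow> ('f, 'r) form set \<Rightarrow> bool" where
  "omits M p \<longleftrightarrow> \<not> (\<exists>a\<in>univ M. realizes M p a)"

definition choice_function ::
  "('f, 'r) form set set \<Rightarrow> (('f, 'r) form set \<Rightarrow> ('f, 'r) form) \<Rightarrow> bool" where
  "choice_function \<Gamma> C \<longleftrightarrow> (\<forall>p\<in>\<Gamma>. C p \<in> p)"

section \<open>Ultrafilters and ultraproducts\<close>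

definition ultrafilter_on :: "'i set \<Rightarrow> 'i set set \<Rightarrow> bool" where
  "ultrafilter_on I U \<longleftrightarrow>
     U \<subseteq> Pow I \<and> I \<in> U \<and> {} \<notin> U \<and>
     (\<forall>X\<in>U. \<forall>Y\<in>U. X \<inter> Y \<in> U) \<and>
     (\<forall>X\<in>U. \<forall>Y. X \<subseteq> Y \<and> Y \<subseteq> I \<longrightarrow> Y \<in> U) \<and>
     (\<forall>X. X \<subseteq> I \<longrightarrow> X \<in> U \<or> I - X \<in> U)"

text \<open>The empty family is excluded because its intersection in \<open>I\<close> is \<open>I \<in> U\<close>,
  whereas \<open>\<Inter>{} = UNIV\<close>.\<close>

definition card_complete :: "'k rel \<Rightarrow> 'i set set \<Rightarrow> bool" where
  "card_complete \<chi> U \<longleftrightarrow> (\<forall>\<A>. \<A> \<subseteq> U \<and> \<A> \<noteq> {} \<and> |\<A>| <o \<chi> \<longrightarrow> \<Inter>\<A> \<in> U)"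

definition product :: "'i set \<Rightarrow> ('i \<Rightarrow> ('f, 'r, 'a) struct) \<Rightarrow> ('i \<Rightarrow> 'a) set" where
  "product I M = (\<Pi>\<^sub>E i\<in>I. univ (M i))"

definition ultra_eq ::
  "'i set \<Rightarrow> ('i \<Rightarrow> ('f, 'r, 'a) struct) \<Rightarrow> 'i set set \<Rightarrow> ('i \<Rightarrow> 'a) rel" where
  "ultra_eq I M U =
     {(f, g). f \<in> product I M \<and> g \<in> product I M \<and> {i\<in>I. f i = g i} \<in> U}"

definition ultraproduct ::
  "'i set \<Rightarrow> ('i \<Rightarrow> ('f, 'r, 'a) struct) \<Rightarrow> 'i set set \<Rightarrow> ('i \<Rightarrow> 'a) set set" where
  "ultraproduct I M U = product I M // ultra_eq I M U"

definition type_product ::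
  "('f, 'r) form set set \<Rightarrow> 'i set \<Rightarrow> ('i \<Rightarrow> ('f, 'r, 'a) struct) \<Rightarrow> 'i set set
    \<Rightarrow> ('i \<Rightarrow> 'a) set" where
  "type_product \<Gamma> I M U =
     {f \<in> product I M. \<exists>X\<in>U. \<exists>C. choice_function \<Gamma> C \<and>
        (\<forall>p\<in>\<Gamma>. \<forall>i\<in>X. sat_at (M i) (Neg (C p)) (f i))}"

definition type_ultraproduct ::
  "('f, 'r) form set set \<Rightarrow> 'i set \<Rightarrow> ('i \<Rightarrow> ('f, 'r, 'a) struct) \<Rightarrow> 'i set set
    \<Rightarrow> ('i \<Rightarrow> 'a) set set" where
  "type_ultraproduct \<Gamma> I M U = (\<lambda>f. ultra_eq I M U `` {f}) ` type_product \<Gamma> I M U"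

end

theory Submission
  imports Defs
begin

text \<open>Passing to the image of \<open>A\<close> under \<open>B\<close> does not raise the
  cardinality, so completeness applies to indexed families, injective or not. It serves twice: for
  the formulas of one type, and for the types in \<open>\<Gamma>\<close>.\<close>

lemma card_complete_INT:
  assumes "card_complete \<chi> U" "A \<noteq> {}" "|A| <o \<chi>" "\<And>a. a \<in> A \<Longrightarrow> B a \<in> U"
  shows "(\<Inter>a\<in>A. B a) \<in> U"
proof -
  have "|B ` A| <o \<chi>"
    using card_of_image assms(3) by (rule ordLeq_ordLess_trans)
  moreover have "B ` A \<subseteq> U" and "B ` A \<noteq> {}"
    using assms by auto
  ultimately show ?thesis
    using assms(1) unfolding card_complete_def by blast
qed

text \<open>As \<open>p\<close> is omitted everywhere, the sets where \<open>\<phi>\<close> holds of \<open>f\<close> have empty intersection over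
  \<open>\<phi> \<in> p\<close>, so by completeness they cannot all lie in \<open>U\<close>.\<close>

lemma omitted_type_uniformly_refuted:
  assumes ultrafilter: "ultrafilter_on I U"
    and complete: "card_complete \<chi> U"
    and card: "|p| <o \<chi>"
    and omitting: "\<And>i. i \<in> I \<Longrightarrow> omits (M i) p"
    and f: "f \<in> product I M"
  shows "\<exists>\<phi>\<in>p. {i \<in> I. sat_at (M i) (Neg \<phi>) (f i)} \<in> U"
proof (rule ccontr)
  assume none: "\<not> ?thesis"
  have refuted: "\<exists>\<phi>\<in>p. \<not> sat_at (M i) \<phi> (f i)" if "i \<in> I" for i
    using omitting[OF that] f that
    by (auto simp: omits_def realizes_def product_def dest: PiE_mem)
  \<comment> \<open>Some index is needed to extract a formula of \<open>p\<close> from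
    \<open>refuted\<close>. Completeness says nothing about the empty family, so
    \<open>p \<noteq> {}\<close> must be secured first.\<close>
  have "I \<noteq> {}"
    using ultrafilter unfolding ultrafilter_on_def by blast
  then have "p \<noteq> {}"
    using refuted by blast
  have "{i \<in> I. sat_at (M i) \<phi> (f i)} \<in> U" if "\<phi> \<in> p" for \<phi>
  proof -
    have "{i \<in> I. sat_at (M i) (Neg \<phi>) (f i)} \<notin> U"
      using none that by blast
    moreover have "\<forall>X. X \<subseteq> I \<longrightarrow> X \<in> U \<or> I - X \<in> U"
      using ultrafilter by (simp add: ultrafilter_on_def)
    \<comment> \<open>An ultrafilter contains a subset of \<open>I\<close> or its complement, and
      the complement of the set where \<open>\<phi>\<close> fails is the set where it holds.\<close>
    ultimately have "I - {i \<in> I. sat_at (M i) (Neg \<phi>) (f i)} \<in> U"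
      by (auto dest!: spec[of _ "{i \<in> I. sat_at (M i) (Neg \<phi>) (f i)}"])
    moreover have "I - {i \<in> I. sat_at (M i) (Neg \<phi>) (f i)} = {i \<in> I. sat_at (M i) \<phi> (f i)}"
      by (auto simp: sat_at_def)
    ultimately show ?thesis
      by simp
  qed
  then have "(\<Inter>\<phi>\<in>p. {i \<in> I. sat_at (M i) \<phi> (f i)}) \<in> U"
    by (rule card_complete_INT[OF complete \<open>p \<noteq> {}\<close> card])
  \<comment> \<open>Since \<open>p \<noteq> {}\<close>, the intersection lies inside
    \<open>I\<close>; each \<open>i\<close> in \<open>I\<close> is then excluded by a formula of
    \<open>p\<close> that fails at \<open>f i\<close>.\<close>
  moreover have "(\<Inter>\<phi>\<in>p. {i \<in> I. sat_at (M i) \<phi> (f i)}) = {}"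
    using refuted \<open>p \<noteq> {}\<close> by blast
  ultimately show False
    using ultrafilter by (simp add: ultrafilter_on_def)
qed

theorem theorem4p6:
  fixes L :: "('f, 'r) language"
    and \<Gamma> :: "('f, 'r) form set set"
    and I :: "'i set"
    and M :: "'i \<Rightarrow> ('f, 'r, 'a) struct"
    and U :: "'i set set"
    and \<chi> :: "'k rel"
  assumes types: "\<And>p. p \<in> \<Gamma> \<Longrightarrow> unary_type L p"
    and structures: "\<And>i. i \<in> I \<Longrightarrow> is_structure L (M i)"
    and omitting: "\<And>i p. i \<in> I \<Longrightarrow> p \<in> \<Gamma> \<Longrightarrow> omits (M i) p"
    and ultrafilter: "ultrafilter_on I U"
    and cardinal: "Card_order \<chi>"
    and complete: "card_complete \<chi> U"
    and card_Gamma: "|\<Gamma>| <o \<chi>"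
    and card_types: "\<And>p. p \<in> \<Gamma> \<Longrightarrow> |p| <o \<chi>"
  shows "type_ultraproduct \<Gamma> I M U = ultraproduct I M U"
proof -
  have "f \<in> type_product \<Gamma> I M U" if f: "f \<in> product I M" for f
  proof -
    let ?R = "\<lambda>\<phi>. {i \<in> I. sat_at (M i) (Neg \<phi>) (f i)}"
    have "\<forall>p\<in>\<Gamma>. \<exists>\<phi>\<in>p. ?R \<phi> \<in> U"
      using omitted_type_uniformly_refuted[OF ultrafilter complete card_types omitting f] by blast
    then obtain C where C: "\<And>p. p \<in> \<Gamma> \<Longrightarrow> C p \<in> p \<and> ?R (C p) \<in> U"
      by metis
    \<comment> \<open>So far the large set \<open>?R (C p)\<close> depends on \<open>p\<close>. A
      second use of completeness, now over \<open>\<Gamma>\<close>, makes it uniform.\<close>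
    have "\<exists>X\<in>U. \<forall>p\<in>\<Gamma>. X \<subseteq> ?R (C p)"
    proof (cases "\<Gamma> = {}")
      case True
      \<comment> \<open>Without types any member of \<open>U\<close> will do, for instance
        \<open>I\<close>.\<close>
      then show ?thesis
        using ultrafilter by (auto simp: ultrafilter_on_def)
    next
      case False
      have "(\<Inter>p\<in>\<Gamma>. ?R (C p)) \<in> U"
        using C by (intro card_complete_INT[OF complete False card_Gamma]) simp
      then show ?thesis
        by (rule bexI[rotated]) (intro ballI INT_lower)
    qed
    then obtain X where X: "X \<in> U" "\<And>p. p \<in> \<Gamma> \<Longrightarrow> X \<subseteq> ?R (C p)"
      by blast
    have "choice_function \<Gamma> C"
      using C by (simp add: choice_function_def)
    moreover have "\<forall>p\<in>\<Gamma>. \<forall>i\<in>X. sat_at (M i) (Neg (C p)) (f i)"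
      using X(2) by auto
    ultimately have "\<exists>X\<in>U. \<exists>C. choice_function \<Gamma> C \<and>
        (\<forall>p\<in>\<Gamma>. \<forall>i\<in>X. sat_at (M i) (Neg (C p)) (f i))"
      using X(1) by (intro bexI[of _ X] exI[of _ C] conjI)
    with f show ?thesis
      unfolding type_product_def by (intro CollectI conjI)
  qed
  then have "type_product \<Gamma> I M U = product I M"
    by (auto simp: type_product_def)
  then show ?thesis
    \<comment> \<open>Both sides are now the set of \<open>ultra_eq\<close> classes of the same
      functions, once as an image and once as a quotient.\<close>
    by (auto simp: type_ultraproduct_def ultraproduct_def quotient_def)
qed

end
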